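(* Let $G$ be a connected graph of order $n\geq 5$ and let $C(G)$ be its central graph. Then: (1) If $\Delta(G)\leq n-3$, then $\chi^{t}_{d}(\overline{G})\leq \chi^{t}_{d}(C(G))\leq \Delta(C(G))+1$. (2) If $G$ is a tree, then $\chi^{t}_{d}(C(G))\leq \Delta(C(G))+1$. Moreover, the upper bounds on $\chi^{t}_{d}(C(G))$ in (1) and (2) are sharp (attained by some graphs satisfying the respective hypotheses).
   Context: All graphs are simple, finite, undirected. $\overline{G}$ is the complement of $G$ and $\Delta(H)$ the maximum degree. The central graph $C(G)$ has vertex set $V(G)\cup\{w_{u,v}:\{u,v\}\in E(G)\}$ and edge set consisting of all pairs of distinct non-adjacent vertices of $G$, together with $\{u,w_{u,v}\}$ and $\{w_{u,v},v\}$ for every $\{u,v\}\in E(G)$. A total dominator coloring (TDC) of a graph $H$ is a proper vertex coloring of $H$ in which every vertex of $H$ is adjacent to every vertex of some (entire) color class. The total dominator chromatic number $\chi^t_d(H)$ is the minimum number of color classes in a TDC of $H$. *)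

theory Defs
  imports "Graph_Theory.Graph_Theory" "HOL-Library.Extended_Nat"
begin

text \<open>
  A finite simple undirected graph is an AFP \<open>pair_graph\<close>: the arc set is a finite symmetric
  irreflexive relation on the vertices, so an edge \<open>{u, v}\<close> is the pair of arcs \<open>(u, v)\<close> and
  \<open>(v, u)\<close>.
\<close>

definition max_degree :: "'a pair_pre_digraph \<Rightarrow> nat" where
  "max_degree H = Max (out_degree (with_proj H) ` pverts H)"

definition complement_graph :: "'a pair_pre_digraph \<Rightarrow> 'a pair_pre_digraph" where
  "complement_graph G =
     \<lparr>pverts = pverts G,
      parcs = {(u, v). u \<in> pverts G \<and> v \<in> pverts G \<and> u \<noteq> v \<and> (u, v) \<notin> parcs G}\<rparr>"

text \<open>
  The library predicate \<open>tree\<close> is about digraphs: it regards \<open>(u, v), (v, u)\<close> as a cycle and so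
  fails for every symmetric graph with an edge. The cycles of an undirected graph are the
  directed ones of length at least 3.
\<close>

definition undirected_tree :: "'a pair_pre_digraph \<Rightarrow> bool" where
  "undirected_tree G \<longleftrightarrow>
     connected (with_proj G) \<and>
     \<not> (\<exists>p. pre_digraph.cycle (with_proj G) p \<and> 3 \<le> length p)"

text \<open>\<open>Sub {u, v}\<close> is the vertex subdividing the edge \<open>{u, v}\<close>.\<close>

datatype 'a central_vertex = Orig 'a | Sub "'a set"

definition central_graph :: "'a pair_pre_digraph \<Rightarrow> 'a central_vertex pair_pre_digraph" where
  "central_graph G =
     \<lparr>pverts = Orig ` pverts G \<union> {Sub {u, v} | u v. (u, v) \<in> parcs G},
      parcs =
        {(Orig u, Orig v) | u v. u \<in> pverts G \<and> v \<in> pverts G \<and> u \<noteq> v \<and> (u, v) \<notin> parcs G} \<union>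
        {(Orig u, Sub {u, v}) | u v. (u, v) \<in> parcs G} \<union>
        {(Sub {u, v}, Orig u) | u v. (u, v) \<in> parcs G}\<rparr>"

definition proper_coloring :: "'a pair_pre_digraph \<Rightarrow> ('a \<Rightarrow> nat) \<Rightarrow> bool" where
  "proper_coloring H c \<longleftrightarrow> (\<forall>(u, v) \<in> parcs H. c u \<noteq> c v)"

definition color_classes :: "'a pair_pre_digraph \<Rightarrow> ('a \<Rightarrow> nat) \<Rightarrow> 'a set set" where
  "color_classes H c = {{v \<in> pverts H. c v = i} | i. i \<in> c ` pverts H}"

definition total_dominator_coloring :: "'a pair_pre_digraph \<Rightarrow> ('a \<Rightarrow> nat) \<Rightarrow> bool" where
  "total_dominator_coloring H c \<longleftrightarrow>
     proper_coloring H c \<and>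
     (\<forall>v \<in> pverts H. \<exists>K \<in> color_classes H c. \<forall>u \<in> K. (v, u) \<in> parcs H)"

text \<open>
  A graph with an isolated vertex has no total dominator coloring; its number is then \<open>\<infinity>\<close>,
  the infimum of the empty set.
\<close>

definition td_chromatic_number :: "'a pair_pre_digraph \<Rightarrow> enat" where
  "td_chromatic_number H =
     (INF c \<in> {c. total_dominator_coloring H c}. enat (card (color_classes H c)))"

lemma pair_graph_complement_graph:
  assumes "pair_graph G"
  shows "pair_graph (complement_graph G)"
proof -
  interpret pair_graph G by (fact assms)
  have sym: "(v, u) \<in> parcs G" if "(u, v) \<in> parcs G" for u v
    using that pair_sym_arcs by (auto simp: symmetric_def dest: symD)
  have "finite (parcs (complement_graph G))"
    by (rule finite_subset[of _ "pverts G \<times> pverts G"])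
      (auto simp: complement_graph_def pair_finite_verts)
  then show ?thesis
    by unfold_locales
      (auto simp: complement_graph_def symmetric_def pair_finite_verts intro!: symI dest: sym)
qed

lemma pair_graph_central_graph:
  assumes "pair_graph G"
  shows "pair_graph (central_graph G)"
proof -
  interpret pair_graph G by (fact assms)
  have sym: "(v, u) \<in> parcs G" if "(u, v) \<in> parcs G" for u v
    using that pair_sym_arcs by (auto simp: symmetric_def dest: symD)
  have "{Sub {u, v} | u v. (u, v) \<in> parcs G} = (\<lambda>(u, v). Sub {u, v}) ` parcs G"
    by auto
  then have fin: "finite (pverts (central_graph G))"
    by (simp add: central_graph_def pair_finite_verts pair_finite_arcs)
  have sub: "parcs (central_graph G) \<subseteq> pverts (central_graph G) \<times> pverts (central_graph G)"
    by (auto simp: central_graph_def dest: wellformed')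
  have "finite (parcs (central_graph G))"
    using finite_subset[OF sub] fin by simp
  moreover have "symmetric (with_proj (central_graph G))"
    unfolding symmetric_def by (rule symI) (auto simp: central_graph_def dest: sym)
  moreover have "fst e \<noteq> snd e" if "e \<in> parcs (central_graph G)" for e
    using that by (auto simp: central_graph_def)
  ultimately show ?thesis
    using fin sub by unfold_locales auto
qed

end

theory Submission
  imports Defs
begin

text \<open>
  Every original vertex has degree \<open>n - 1\<close> in \<open>C(G)\<close> and every subdividing vertex has degree 2,
  so \<open>\<Delta>(C(G)) + 1 = n\<close>. For the upper bounds, give the two ends of a suitable edge \<open>ab\<close> a common
  color, all other original vertices their own colors, and all subdividing vertices one further
  color.

  In a TDC of \<open>C(G)\<close>, the vertex subdividing \<open>uv\<close> forces one of \<open>{u}\<close>, \<open>{v}\<close>, \<open>{u, v}\<close> to be a color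
  class. Hence, if \<open>G\<close> has an edge and every edge of \<open>G\<close> is dominating, a TDC of \<open>C(G)\<close> has at least
  \<open>n\<close> colors, which makes \<open>K\<^sub>3\<^sub>,\<^sub>3\<close> and the star \<open>K\<^sub>1\<^sub>,\<^sub>4\<close> extremal. For the bound on the complement,
  let \<open>U\<close> be the set of vertices not dominated by the restriction of a TDC of \<open>C(G)\<close> to \<open>V(G)\<close>. If
  \<open>U\<close> is nonempty, the restriction has lost a class of subdividing vertices. The members of \<open>U\<close> are
  singleton classes and pairwise adjacent in \<open>G\<close>; merge them into one class and make, for each
  \<open>u \<in> U\<close>, one non-neighbour of \<open>u\<close> a singleton class. This raises the number of colors by at most one.
\<close>

section \<open>Arcs of a symmetric graph, of its complement and of its central graph\<close>

lemma finite_pverts: "pair_graph H \<Longrightarrow> finite (pverts H)"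
  by (simp add: pair_graph_def pair_digraph_def pair_fin_digraph_def pair_fin_digraph_axioms_def)

lemma arc_in_pverts:
  assumes "pair_graph H" "(u, v) \<in> parcs H"
  shows "u \<in> pverts H" "v \<in> pverts H"
proof -
  interpret pair_graph H by (fact assms)
  show "u \<in> pverts H" "v \<in> pverts H" using assms(2) by (auto dest: wellformed')
qed

lemma arc_neq:
  assumes "pair_graph H" "(u, v) \<in> parcs H"
  shows "u \<noteq> v"
proof -
  interpret pair_graph H by (fact assms)
  show ?thesis using pair_no_loops[OF assms(2)] by simp
qed

lemma no_loop: "pair_graph H \<Longrightarrow> (u, u) \<notin> parcs H"
  by (metis arc_neq)

lemma arc_sym:
  assumes "pair_graph H" "(u, v) \<in> parcs H"
  shows "(v, u) \<in> parcs H"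
proof -
  interpret pair_graph H by (fact assms)
  show ?thesis using assms(2) pair_sym_arcs by (auto simp: symmetric_def dest: symD)
qed

lemma arcs_complement_iff:
  "(u, v) \<in> parcs (complement_graph G) \<longleftrightarrow>
     u \<in> pverts G \<and> v \<in> pverts G \<and> u \<noteq> v \<and> (u, v) \<notin> parcs G"
  by (simp add: complement_graph_def)

lemma pverts_complement [simp]: "pverts (complement_graph G) = pverts G"
  by (simp add: complement_graph_def)

lemma pverts_central:
  "pverts (central_graph G) = Orig ` pverts G \<union> {Sub {u, v} | u v. (u, v) \<in> parcs G}"
  by (simp add: central_graph_def)

lemma arcs_central_iff [simp]:
  "(Orig u, Orig v) \<in> parcs (central_graph G) \<longleftrightarrow> (u, v) \<in> parcs (complement_graph G)"
  "(Orig u, Sub e) \<in> parcs (central_graph G) \<longleftrightarrow> (\<exists>v. (u, v) \<in> parcs G \<and> e = {u, v})"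
  "(Sub e, Orig u) \<in> parcs (central_graph G) \<longleftrightarrow> (\<exists>v. (u, v) \<in> parcs G \<and> e = {u, v})"
  "(Sub e, Sub f) \<notin> parcs (central_graph G)"
  by (auto simp: central_graph_def complement_graph_def)

lemma Orig_in_central [simp]: "Orig v \<in> pverts (central_graph G) \<longleftrightarrow> v \<in> pverts G"
  by (auto simp: pverts_central)

lemma Sub_in_central: "(u, v) \<in> parcs G \<Longrightarrow> Sub {u, v} \<in> pverts (central_graph G)"
  by (auto simp: pverts_central)

section \<open>Counting the colors of a total dominator coloring\<close>

lemma card_color_classes: "card (color_classes H c) = card (c ` pverts H)"
proof -
  have "color_classes H c = (\<lambda>i. {v \<in> pverts H. c v = i}) ` c ` pverts H"
    by (auto simp: color_classes_def)
  moreover have "inj_on (\<lambda>i. {v \<in> pverts H. c v = i}) (c ` pverts H)"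
    by (auto simp: inj_on_def)
  ultimately show ?thesis by (simp add: card_image)
qed

text \<open>Color classes are nonempty, so each is the class of one of its members \<open>u\<close>;
  quantifying over representatives avoids sets of sets in all later arguments.\<close>

lemma total_dominator_coloring_iff:
  "total_dominator_coloring H c \<longleftrightarrow>
     (\<forall>u v. (u, v) \<in> parcs H \<longrightarrow> c u \<noteq> c v) \<and>
     (\<forall>v \<in> pverts H. \<exists>u \<in> pverts H. \<forall>x \<in> pverts H. c x = c u \<longrightarrow> (v, x) \<in> parcs H)"
proof -
  have classes: "(\<exists>K \<in> color_classes H c. P K) \<longleftrightarrow>
      (\<exists>u \<in> pverts H. P {x \<in> pverts H. c x = c u})" for P
    by (auto simp: color_classes_def)
  have "proper_coloring H c \<longleftrightarrow> (\<forall>u v. (u, v) \<in> parcs H \<longrightarrow> c u \<noteq> c v)"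
    by (auto simp: proper_coloring_def)
  then show ?thesis
    by (simp only: total_dominator_coloring_def classes Ball_def mem_Collect_eq imp_conjL)
qed

text \<open>The finitely many colors in use inject into the natural numbers, so colorings may be
  built in any color type. Option and sum types below keep new colors apart from old ones.\<close>

lemma td_chromatic_number_le:
  fixes c :: "'a \<Rightarrow> 'b"
  assumes H: "pair_graph H"
    and proper: "\<And>u v. (u, v) \<in> parcs H \<Longrightarrow> c u \<noteq> c v"
    and dom: "\<And>v. v \<in> pverts H \<Longrightarrow>
      \<exists>u \<in> pverts H. \<forall>x \<in> pverts H. c x = c u \<longrightarrow> (v, x) \<in> parcs H"
    and card: "card (c ` pverts H) \<le> k"
  shows "td_chromatic_number H \<le> enat k"
proof -
  obtain f :: "'b \<Rightarrow> nat" where f: "inj_on f (c ` pverts H)"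
    using finite_imp_inj_to_nat_seg[of "c ` pverts H"] finite_pverts[OF H] by auto
  then have f_eq: "f (c x) = f (c y) \<longleftrightarrow> c x = c y" if "x \<in> pverts H" "y \<in> pverts H" for x y
    using that by (auto simp: inj_on_def)
  have "total_dominator_coloring H (f \<circ> c)"
    unfolding total_dominator_coloring_iff
  proof (intro conjI allI impI ballI)
    fix u v assume uv: "(u, v) \<in> parcs H"
    show "(f \<circ> c) u \<noteq> (f \<circ> c) v"
      using proper[OF uv] arc_in_pverts[OF H uv] by (simp add: f_eq)
  next
    fix v assume "v \<in> pverts H"
    from dom[OF this] obtain u where
      "u \<in> pverts H" "\<forall>x \<in> pverts H. c x = c u \<longrightarrow> (v, x) \<in> parcs H" by blast
    then show "\<exists>u \<in> pverts H. \<forall>x \<in> pverts H. (f \<circ> c) x = (f \<circ> c) u \<longrightarrow> (v, x) \<in> parcs H"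
      by (intro bexI[of _ u]) (auto simp: f_eq)
  qed
  then have "td_chromatic_number H \<le> enat (card (color_classes H (f \<circ> c)))"
    unfolding td_chromatic_number_def by (intro INF_lower) simp
  also have "card (color_classes H (f \<circ> c)) = card (c ` pverts H)"
    using card_image[OF f] by (simp add: card_color_classes image_image)
  finally show ?thesis using card by (meson enat_ord_simps(1) order_trans)
qed

lemma td_chromatic_number_ge:
  assumes "\<And>c. total_dominator_coloring H c \<Longrightarrow> n \<le> enat (card (c ` pverts H))"
  shows "n \<le> td_chromatic_number H"
  unfolding td_chromatic_number_def using assms by (intro INF_greatest) (simp add: card_color_classes)

section \<open>Degrees and non-neighbours\<close>

text \<open>Each vertex \<open>v\<close> other than \<open>u\<close> accounts for exactly one
  neighbour of \<open>Orig u\<close>: the vertex \<open>Sub {u, v}\<close> if \<open>uv\<close> is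
  an edge, and \<open>Orig v\<close> otherwise. Subdividing vertices have degree at most 2, which is
  at most \<open>n - 1\<close> once \<open>n\<close> is at least 3.\<close>

lemma max_degree_central:
  assumes G: "pair_graph G" and n: "3 \<le> card (pverts G)"
  shows "max_degree (central_graph G) = card (pverts G) - 1"
proof -
  let ?H = "central_graph G"
  have fin: "finite (pverts G)" by (rule finite_pverts[OF G])
  have Orig: "out_degree (with_proj ?H) (Orig u) = card (pverts G) - 1" if u: "u \<in> pverts G" for u
  proof -
    define h where "h v = (if (u, v) \<in> parcs G then Sub {u, v} else Orig v)" for v
    have "out_arcs (with_proj ?H) (Orig u) = (\<lambda>v. (Orig u, h v)) ` (pverts G - {u})"
    proof (intro set_eqI iffI)
      fix e assume e: "e \<in> out_arcs (with_proj ?H) (Orig u)"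
      then obtain y where y: "e = (Orig u, y)" "(Orig u, y) \<in> parcs ?H"
        by (cases e) (auto simp: out_arcs_def)
      show "e \<in> (\<lambda>v. (Orig u, h v)) ` (pverts G - {u})"
      proof (cases y)
        case (Orig v)
        then show ?thesis using y by (auto simp: arcs_complement_iff h_def)
      next
        case (Sub s)
        then obtain v where "(u, v) \<in> parcs G" "s = {u, v}" using y by auto
        then show ?thesis
          using y Sub arc_in_pverts[OF G] no_loop[OF G]
          by (intro image_eqI[of _ _ v]) (auto simp: h_def)
      qed
    qed (auto simp: out_arcs_def h_def arcs_complement_iff u)
    moreover have "inj_on (\<lambda>v. (Orig u, h v)) (pverts G - {u})"
      by (auto simp: inj_on_def h_def doubleton_eq_iff split: if_splits)
    ultimately show ?thesis using fin u by (simp add: out_degree_def card_image)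
  qed
  have Sub: "out_degree (with_proj ?H) (Sub {u, v}) \<le> 2" for u v
  proof -
    have "out_arcs (with_proj ?H) (Sub {u, v}) \<subseteq> {(Sub {u, v}, Orig u), (Sub {u, v}, Orig v)}"
    proof
      fix e assume "e \<in> out_arcs (with_proj ?H) (Sub {u, v})"
      then obtain y where y: "e = (Sub {u, v}, y)" "(Sub {u, v}, y) \<in> parcs ?H"
        by (cases e) (auto simp: out_arcs_def)
      then show "e \<in> {(Sub {u, v}, Orig u), (Sub {u, v}, Orig v)}"
        by (cases y) (auto simp: doubleton_eq_iff)
    qed
    from card_mono[OF _ this] show ?thesis
      by (simp add: out_degree_def card_insert_if split: if_splits)
  qed
  have "finite (pverts ?H)" by (rule finite_pverts[OF pair_graph_central_graph[OF G]])
  moreover obtain u where "u \<in> pverts G" using n by fastforce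
  ultimately show ?thesis
    unfolding max_degree_def using Orig Sub n
    by (intro Max_eqI) (auto simp: pverts_central intro!: image_eqI[of _ _ "Orig u"] order_trans[OF Sub])
qed

lemma card_neighbours_eq_out_degree:
  assumes "pair_graph G"
  shows "card {v. (u, v) \<in> parcs G} = out_degree (with_proj G) u"
proof -
  have "out_arcs (with_proj G) u = Pair u ` {v. (u, v) \<in> parcs G}"
    by (auto simp: out_arcs_def)
  then show ?thesis by (simp add: out_degree_def card_image inj_on_def)
qed

lemma card_non_neighbours:
  assumes G: "pair_graph G" and u: "u \<in> pverts G"
  shows "card {v. (u, v) \<in> parcs (complement_graph G)} + out_degree (with_proj G) u + 1
    = card (pverts G)"
proof -
  let ?N = "{v. (u, v) \<in> parcs G}" and ?M = "{v. (u, v) \<in> parcs (complement_graph G)}"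
  have fin: "finite (pverts G)" by (rule finite_pverts[OF G])
  have split: "pverts G = insert u (?M \<union> ?N)" and disj: "?M \<inter> ?N = {}" "u \<notin> ?M \<union> ?N"
    using u arc_in_pverts[OF G] no_loop[OF G] by (auto simp: arcs_complement_iff)
  have fins: "finite ?M" "finite ?N"
    by (rule finite_subset[OF _ fin]; use split in auto)+
  have "card (pverts G) = Suc (card (?M \<union> ?N))"
    unfolding split[symmetric] using split disj fins by (metis card_insert_disjoint finite_UnI)
  then show ?thesis
    using card_Un_disjoint[OF fins disj(1)] card_neighbours_eq_out_degree[OF G] by simp
qed

text \<open>Of the \<open>n - 1\<close> other vertices at most \<open>n - 3\<close> are neighbours
  of \<open>u\<close>.\<close>

lemma ex_two_non_neighbours:
  assumes G: "pair_graph G" and n: "5 \<le> card (pverts G)"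
    and deg: "max_degree G \<le> card (pverts G) - 3" and u: "u \<in> pverts G"
  shows "\<exists>x y. x \<noteq> y \<and> (u, x) \<in> parcs (complement_graph G) \<and>
    (u, y) \<in> parcs (complement_graph G)"
proof -
  have "out_degree (with_proj G) u \<le> max_degree G"
    unfolding max_degree_def using u finite_pverts[OF G] by (intro Max_ge) auto
  then have "2 \<le> card {v. (u, v) \<in> parcs (complement_graph G)}"
    using card_non_neighbours[OF G u] deg n by linarith
  then show ?thesis
    by (auto simp: numeral_2_eq_2 card_le_Suc_iff)
qed

lemma connected_ex_arc:
  assumes G: "pair_graph G" and con: "connected (with_proj G)"
    and u: "u \<in> pverts G" and v: "v \<in> pverts G" "u \<noteq> v"
  obtains w where "(u, w) \<in> parcs G"
proof -
  interpret pair_graph G by (fact G)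
  have "u \<rightarrow>\<^sup>*\<^bsub>with_proj G\<^esub> v"
    using symmetric_connected_imp_strongly_connected[OF pair_sym_arcs con] u v
    by (auto simp: strongly_connected_def)
  then show ?thesis using v that
    by (cases rule: converse_reachable_cases) auto
qed

section \<open>Upper bounds from giving the ends of an edge a common color\<close>

text \<open>The alternatives in \<open>dom\<close> are the three kinds of class an original vertex
  can dominate: a singleton \<open>{y}\<close>, the pair \<open>{a, b}\<close>, or the class of all
  subdividing vertices. Subdividing vertices need no hypothesis: each has an end outside
  \<open>{a, b}\<close>, which is a singleton class, or is the one on \<open>ab\<close>, which
  dominates the pair.\<close>

lemma td_chromatic_number_central_le:
  assumes G: "pair_graph G" and ab: "(a, b) \<in> parcs G"
    and dom: "\<And>x. x \<in> pverts G \<Longrightarrow>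
        (\<exists>y. y \<notin> {a, b} \<and> (x, y) \<in> parcs (complement_graph G))
        \<or> {(x, a), (x, b)} \<subseteq> parcs (complement_graph G)
        \<or> (\<forall>u v. (u, v) \<in> parcs G \<longrightarrow> x \<in> {u, v})"
  shows "td_chromatic_number (central_graph G) \<le> enat (card (pverts G))"
proof -
  note inV = arc_in_pverts[OF G]
  \<comment> \<open>\<open>None\<close> is the color of all subdividing vertices, and
    \<open>b\<close> borrows the color of \<open>a\<close>. This is proper because \<open>a\<close>
    and \<open>b\<close> are adjacent in \<open>G\<close>, hence not in the central graph.\<close>
  define c where "c z = (case z of Orig x \<Rightarrow> Some (if x = b then a else x) | Sub e \<Rightarrow> None)" for z
  show ?thesis
  proof (rule td_chromatic_number_le[where c = c])
    show "pair_graph (central_graph G)" by (rule pair_graph_central_graph[OF G])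
  next
    fix u v assume "(u, v) \<in> parcs (central_graph G)"
    then show "c u \<noteq> c v" using ab arc_sym[OF G ab]
      by (cases u; cases v) (auto simp: c_def arcs_complement_iff)
  next
    fix v assume v: "v \<in> pverts (central_graph G)"
    show "\<exists>u \<in> pverts (central_graph G). \<forall>x \<in> pverts (central_graph G).
      c x = c u \<longrightarrow> (v, x) \<in> parcs (central_graph G)" (is "\<exists>u \<in> _. ?D v u")
    proof (cases v)
      case (Orig x)
      then have "x \<in> pverts G" using v by simp
      from dom[OF this] consider
          (single) y where "y \<notin> {a, b}" "(x, y) \<in> parcs (complement_graph G)"
        | (pair) "{(x, a), (x, b)} \<subseteq> parcs (complement_graph G)"
        | (subs) "\<forall>u v. (u, v) \<in> parcs G \<longrightarrow> x \<in> {u, v}"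
        by blast
      then show ?thesis
      proof cases
        case single
        then have "?D v (Orig y)" using Orig
          by (auto simp: c_def split: central_vertex.splits if_splits)
        then show ?thesis using single by (intro bexI[of _ "Orig y"]) (auto simp: arcs_complement_iff)
      next
        case pair
        then have "?D v (Orig a)" using Orig
          by (auto simp: c_def split: central_vertex.splits if_splits)
        then show ?thesis using inV[OF ab] by (intro bexI[of _ "Orig a"]) auto
      next
        case subs
        have "?D v (Sub {a, b})"
        proof (intro ballI impI)
          fix z assume z: "z \<in> pverts (central_graph G)" "c z = c (Sub {a, b})"
          then obtain p q where pq: "z = Sub {p, q}" "(p, q) \<in> parcs G"
            by (auto simp: c_def pverts_central)
          with subs have "x = p \<or> x = q" by blast
          then show "(v, z) \<in> parcs (central_graph G)"
            using pq Orig arc_sym[OF G pq(2)] by (auto simp: insert_commute)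
        qed
        then show ?thesis using Sub_in_central[OF ab] by blast
      qed
    next
      case (Sub e)
      then obtain p q where pq: "e = {p, q}" "(p, q) \<in> parcs G" using v by (auto simp: pverts_central)
      have endpoint: "\<exists>u \<in> pverts (central_graph G). ?D v u"
        if "(r, s) \<in> parcs G" "e = {r, s}" "r \<notin> {a, b}" for r s
      proof -
        have "?D v (Orig r)" using that Sub
          by (auto simp: c_def split: central_vertex.splits if_splits)
        then show ?thesis using inV[OF that(1)] by (intro bexI[of _ "Orig r"]) auto
      qed
      show ?thesis
      proof (cases "p \<in> {a, b} \<and> q \<in> {a, b}")
        case True
        then have "e = {a, b}" using pq arc_neq[OF G pq(2)] by auto
        then have "?D v (Orig a)" using ab arc_sym[OF G ab] Sub
          by (auto simp: c_def insert_commute split: central_vertex.splits if_splits)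
        then show ?thesis using inV[OF ab] by (intro bexI[of _ "Orig a"]) auto
      next
        case False
        then show ?thesis
          using endpoint[OF pq(2,1)] endpoint[OF arc_sym[OF G pq(2)]] pq by (auto simp: insert_commute)
      qed
    qed
  next
    have fin: "finite (pverts G)" by (rule finite_pverts[OF G])
    \<comment> \<open>The color \<open>Some b\<close> never occurs, which makes room for
      \<open>None\<close> within \<open>n\<close> colors.\<close>
    have "c ` pverts (central_graph G) \<subseteq> insert None (Some ` (pverts G - {b}))"
      using inV[OF ab] arc_neq[OF G ab] by (auto simp: c_def pverts_central)
    then have "card (c ` pverts (central_graph G)) \<le> card (insert None (Some ` (pverts G - {b})))"
      using fin by (intro card_mono) auto
    also have "\<dots> = Suc (card (pverts G - {b}))"
      using fin by (subst card_insert_disjoint) (auto simp: card_image)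
    also have "\<dots> = card (pverts G)" using card_Suc_Diff1[OF fin inV(2)[OF ab]] .
    finally show "card (c ` pverts (central_graph G)) \<le> card (pverts G)" .
  qed
qed

text \<open>Any edge \<open>ab\<close> serves: two distinct non-neighbours of \<open>x\<close>
  either include one outside \<open>{a, b}\<close> or are \<open>a\<close> and \<open>b\<close>
  themselves.\<close>

lemma td_chromatic_number_central_le_low_degree:
  assumes G: "pair_graph G" and con: "connected (with_proj G)" and n: "5 \<le> card (pverts G)"
    and deg: "max_degree G \<le> card (pverts G) - 3"
  shows "td_chromatic_number (central_graph G) \<le> enat (card (pverts G))"
proof -
  obtain a where a: "a \<in> pverts G" using n by fastforce
  obtain z where "(a, z) \<in> parcs (complement_graph G)"
    using ex_two_non_neighbours[OF G n deg a] by blast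
  then obtain b where ab: "(a, b) \<in> parcs G"
    using connected_ex_arc[OF G con a, of z] by (auto simp: arcs_complement_iff)
  show ?thesis
  proof (rule td_chromatic_number_central_le[OF G ab])
    fix x assume "x \<in> pverts G"
    from ex_two_non_neighbours[OF G n deg this] obtain y z where
      "y \<noteq> z" "(x, y) \<in> parcs (complement_graph G)" "(x, z) \<in> parcs (complement_graph G)"
      by blast
    then show "(\<exists>y. y \<notin> {a, b} \<and> (x, y) \<in> parcs (complement_graph G))
        \<or> {(x, a), (x, b)} \<subseteq> parcs (complement_graph G)
        \<or> (\<forall>u v. (u, v) \<in> parcs G \<longrightarrow> x \<in> {u, v})"
      by (cases "y \<in> {a, b}"; cases "z \<in> {a, b}") auto
  qed
qed

text \<open>Cycles of length 3 and 4 are the only ones the coloring argument for trees has to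
  exclude.\<close>

lemma undirected_tree_no_short_cycle:
  assumes G: "pair_graph G" and tree: "undirected_tree G"
  shows no_triangle: "(x, y) \<in> parcs G \<Longrightarrow> (y, z) \<in> parcs G \<Longrightarrow> (z, x) \<notin> parcs G"
    and no_square: "(w, x) \<in> parcs G \<Longrightarrow> (x, y) \<in> parcs G \<Longrightarrow> (y, z) \<in> parcs G \<Longrightarrow>
      (z, w) \<in> parcs G \<Longrightarrow> w = y \<or> x = z"
proof -
  interpret pair_graph G by (fact G)
  have no_cycle: "\<not> cycle p" if "3 \<le> length p" for p
    using tree that by (auto simp: undirected_tree_def)
  show "(z, x) \<notin> parcs G" if "(x, y) \<in> parcs G" "(y, z) \<in> parcs G"
  proof
    assume "(z, x) \<in> parcs G"
    with that have "cycle [(x, y), (y, z), (z, x)]"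
      unfolding cycle_def
      by (intro exI[of _ x]) (auto simp: awalk_def dest: arc_neq[OF G] arc_in_pverts[OF G])
    then show False using no_cycle by simp
  qed
  show "w = y \<or> x = z" if "(w, x) \<in> parcs G" "(x, y) \<in> parcs G" "(y, z) \<in> parcs G" "(z, w) \<in> parcs G"
  proof (rule ccontr)
    assume "\<not> (w = y \<or> x = z)"
    with that have "cycle [(w, x), (x, y), (y, z), (z, w)]"
      unfolding cycle_def
      by (intro exI[of _ w]) (auto simp: awalk_def dest: arc_neq[OF G] arc_in_pverts[OF G])
    then show False using no_cycle by simp
  qed
qed

text \<open>If the maximum degree exceeds \<open>n - 3\<close>, some vertex \<open>v\<close> has at
  most one non-neighbour \<open>q\<close>. The glued edge is \<open>vb\<close>, with
  \<open>b\<close> a neighbour of \<open>q\<close> if \<open>q\<close> exists. Then \<open>v\<close>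
  dominates \<open>{q}\<close>, or else every edge contains \<open>v\<close>; any other vertex
  \<open>x\<close> dominates \<open>{y}\<close> for a suitable neighbour \<open>y\<close> of
  \<open>v\<close>.\<close>

lemma td_chromatic_number_central_le_tree:
  assumes G: "pair_graph G" and con: "connected (with_proj G)" and n: "5 \<le> card (pverts G)"
    and tree: "undirected_tree G"
  shows "td_chromatic_number (central_graph G) \<le> enat (card (pverts G))"
proof (cases "max_degree G \<le> card (pverts G) - 3")
  case True
  then show ?thesis by (rule td_chromatic_number_central_le_low_degree[OF G con n])
next
  case False
  note sym = arc_sym[OF G] and inV = arc_in_pverts[OF G] and neq = arc_neq[OF G]
  note triangle = no_triangle[OF G tree] and square = no_square[OF G tree]
  have "pverts G \<noteq> {}" using n by auto
  then have "max_degree G \<in> out_degree (with_proj G) ` pverts G"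
    unfolding max_degree_def using finite_pverts[OF G] by (intro Max_in) auto
  then obtain v where v: "v \<in> pverts G" "card (pverts G) - 3 < out_degree (with_proj G) v"
    using False by auto
  let ?N = "{l. (v, l) \<in> parcs G}" and ?M = "{q. (v, q) \<in> parcs (complement_graph G)}"
  \<comment> \<open>The degree of \<open>v\<close> is at least \<open>n - 2\<close>, and
    \<open>n\<close> is at least 5. Three neighbours allow choosing one that avoids two given
    vertices.\<close>
  have N: "3 \<le> card ?N" and M: "card ?M \<le> 1"
    using card_non_neighbours[OF G v(1)] v(2) n by (simp_all add: card_neighbours_eq_out_degree[OF G])
  have finM: "finite ?M"
    by (rule finite_subset[OF _ finite_pverts[OF G]]) (auto simp: arcs_complement_iff)
  have third: "\<exists>l. (v, l) \<in> parcs G \<and> l \<notin> {x, y}" for x y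
  proof (rule ccontr)
    assume "\<not> ?thesis"
    then have "?N \<subseteq> {x, y}" by auto
    from card_mono[OF _ this] N show False by (simp add: card_insert_if split: if_splits)
  qed
  have M_eq: "q = q'"
    if "(v, q) \<in> parcs (complement_graph G)" "(v, q') \<in> parcs (complement_graph G)" for q q'
    using M that finM card_le_Suc0_iff_eq[OF finM] by auto
  obtain b where vb: "(v, b) \<in> parcs G"
    and bM: "\<And>q. (v, q) \<in> parcs (complement_graph G) \<Longrightarrow> (q, b) \<in> parcs G"
  proof (cases "?M = {}")
    case True
    then show ?thesis using that third by blast
  next
    case False
    then obtain q where q: "(v, q) \<in> parcs (complement_graph G)" by auto
    obtain b where b: "(q, b) \<in> parcs G"
      using connected_ex_arc[OF G con, of q v] q by (auto simp: arcs_complement_iff)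
    \<comment> \<open>Otherwise \<open>b\<close> would be a second non-neighbour of
      \<open>v\<close>.\<close>
    have "(v, b) \<in> parcs G"
    proof (rule ccontr)
      assume "(v, b) \<notin> parcs G"
      moreover have "b \<noteq> v" using b q sym by (auto simp: arcs_complement_iff)
      ultimately have "(v, b) \<in> parcs (complement_graph G)"
        using v inV[OF b] by (auto simp: arcs_complement_iff)
      then show False using M_eq[OF q] neq[OF b] by blast
    qed
    then show ?thesis using that b M_eq[OF q] by blast
  qed
  show ?thesis
  proof (rule td_chromatic_number_central_le[OF G vb])
    fix x assume x: "x \<in> pverts G"
    show "(\<exists>y. y \<notin> {v, b} \<and> (x, y) \<in> parcs (complement_graph G))
        \<or> {(x, v), (x, b)} \<subseteq> parcs (complement_graph G)
        \<or> (\<forall>p q. (p, q) \<in> parcs G \<longrightarrow> x \<in> {p, q})"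
    proof (cases "x = v")
      case True
      show ?thesis
      proof (cases "?M = {}")
        case M: True
        \<comment> \<open>Here \<open>v\<close> is adjacent to all other vertices, so an edge
          \<open>pq\<close> avoiding it would close a triangle.\<close>
        have "v \<in> {p, q}" if "(p, q) \<in> parcs G" for p q
        proof (rule ccontr)
          assume "v \<notin> {p, q}"
          then have "(v, p) \<in> parcs G" "(v, q) \<in> parcs G"
            using M v inV[OF that] by (auto simp: arcs_complement_iff)
          then show False using triangle[of v p q] that sym by blast
        qed
        then show ?thesis using True by blast
      next
        case False
        then obtain q where "(v, q) \<in> parcs (complement_graph G)" by auto
        then show ?thesis using True vb by (auto simp: arcs_complement_iff)
      qed
    next
      case False
      obtain y where y: "(v, y) \<in> parcs G" "y \<notin> {x, b}" using third by blast
      \<comment> \<open>If \<open>x\<close> is adjacent to \<open>v\<close>, the edge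
        \<open>xy\<close> closes the triangle \<open>v x y\<close>. If not, \<open>x\<close> is the
        non-neighbour of \<open>v\<close>, hence adjacent to \<open>b\<close>, and \<open>xy\<close>
        closes the square \<open>v y x b\<close>.\<close>
      have "(x, y) \<notin> parcs G"
      proof
        assume xy: "(x, y) \<in> parcs G"
        show False
        proof (cases "(v, x) \<in> parcs G")
          case True
          then show False using triangle[of v x y] xy y sym by blast
        next
          case nadj: False
          then have "(x, b) \<in> parcs G"
            using bM x v False by (auto simp: arcs_complement_iff)
          then show False using square[of v y x b] y xy vb sym False by blast
        qed
      qed
      then have "(x, y) \<in> parcs (complement_graph G)"
        using x y inV[OF y(1)] by (auto simp: arcs_complement_iff)
      moreover have "y \<notin> {v, b}" using y neq by auto
      ultimately show ?thesis by blast
    qed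
  qed
qed

section \<open>Structure of total dominator colorings of the central graph, and a lower
  bound\<close>

text \<open>The only neighbours of \<open>Sub {u, v}\<close> are \<open>Orig u\<close> and
  \<open>Orig v\<close>, so the class it dominates is one of the three nonempty subsets of this
  pair.\<close>

lemma central_coloring_edge:
  assumes G: "pair_graph G" and c: "total_dominator_coloring (central_graph G) c"
    and uv: "(u, v) \<in> parcs G"
  obtains "\<And>z. z \<in> pverts (central_graph G) \<Longrightarrow> c z = c (Orig u) \<Longrightarrow> z = Orig u"
  | "\<And>z. z \<in> pverts (central_graph G) \<Longrightarrow> c z = c (Orig v) \<Longrightarrow> z = Orig v"
  | "c (Orig u) = c (Orig v)"
    "\<And>z. z \<in> pverts (central_graph G) \<Longrightarrow> c z = c (Orig u) \<Longrightarrow> z \<in> {Orig u, Orig v}"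
proof -
  obtain w where w: "w \<in> pverts (central_graph G)"
    and dom: "\<And>x. x \<in> pverts (central_graph G) \<Longrightarrow> c x = c w \<Longrightarrow>
      (Sub {u, v}, x) \<in> parcs (central_graph G)"
    using c Sub_in_central[OF uv] unfolding total_dominator_coloring_iff by blast
  have ends: "x \<in> {Orig u, Orig v}" if "x \<in> pverts (central_graph G)" "c x = c w" for x
    using dom[OF that] by (cases x) (auto simp: doubleton_eq_iff)
  show ?thesis
  proof (cases "c (Orig u) = c (Orig v)")
    case True
    moreover have "c w = c (Orig u)" using ends[OF w] True by auto
    ultimately show ?thesis using that(3) ends by metis
  next
    case False
    then show ?thesis using that(1,2) ends ends[OF w] by (metis insertE singletonD)
  qed
qed

lemma central_coloring_monochromatic_arc:
  assumes c: "total_dominator_coloring (central_graph G) c"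
    and "u \<in> pverts G" "v \<in> pverts G" "u \<noteq> v" "c (Orig u) = c (Orig v)"
  shows "(u, v) \<in> parcs G"
  using assms unfolding total_dominator_coloring_iff
  by (metis arcs_central_iff(1) arcs_complement_iff)

text \<open>If two original vertices \<open>a\<close> and \<open>b\<close> share a color, they are
  adjacent in \<open>G\<close> and, neither being a singleton class, form a class together. Any
  other \<open>x\<close> is adjacent to one of them, and that edge forces \<open>{x}\<close> to be a
  class. The originals thus use \<open>n - 1\<close> colors and \<open>Sub {a, b}\<close> needs
  another one.\<close>

lemma card_pverts_le_td_chromatic_number_central:
  assumes G: "pair_graph G" and ne: "parcs G \<noteq> {}"
    and edge_dom: "\<And>a b x. (a, b) \<in> parcs G \<Longrightarrow> x \<in> pverts G - {a, b} \<Longrightarrow>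
      (x, a) \<in> parcs G \<or> (x, b) \<in> parcs G"
  shows "enat (card (pverts G)) \<le> td_chromatic_number (central_graph G)"
proof (rule td_chromatic_number_ge)
  fix c assume c: "total_dominator_coloring (central_graph G) c"
  let ?H = "central_graph G"
  have finH: "finite (pverts ?H)" by (rule finite_pverts[OF pair_graph_central_graph[OF G]])
  have "card (pverts G) \<le> card (c ` pverts ?H)"
  proof (cases "inj_on (c \<circ> Orig) (pverts G)")
    case True
    have "(c \<circ> Orig) ` pverts G \<subseteq> c ` pverts ?H" by auto
    with card_mono[OF _ this] finH card_image[OF True] show ?thesis by simp
  next
    case False
    then obtain a b where ab: "a \<in> pverts G" "b \<in> pverts G" "a \<noteq> b" "c (Orig a) = c (Orig b)"
      by (auto simp: inj_on_def)
    then have arc: "(a, b) \<in> parcs G" by (intro central_coloring_monochromatic_arc[OF c])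
    have not_single: "\<not> (\<forall>z \<in> pverts ?H. c z = c (Orig a) \<longrightarrow> z = Orig a)"
      "\<not> (\<forall>z \<in> pverts ?H. c z = c (Orig b) \<longrightarrow> z = Orig b)"
      using ab by (metis Orig_in_central central_vertex.inject(1))+
    have pair: "z \<in> {Orig a, Orig b}" if "z \<in> pverts ?H" "c z = c (Orig a)" for z
      using central_coloring_edge[OF G c arc] not_single that by metis
    have single: "z = Orig x"
      if x: "x \<in> pverts G - {a, b}" and z: "z \<in> pverts ?H" "c z = c (Orig x)" for x z
    proof -
      have x_ab: "c (Orig x) \<noteq> c (Orig a)" using pair[of "Orig x"] x by auto
      obtain d where "d \<in> {a, b}" "(x, d) \<in> parcs G" using edge_dom[OF arc x] by auto
      then show ?thesis
        using central_coloring_edge[OF G c \<open>(x, d) \<in> parcs G\<close>] not_single x_ab ab(4) z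
        by (metis insertE singletonD)
    qed
    \<comment> \<open>All classes meeting the originals have been shown to consist of originals
      only.\<close>
    have new: "c (Sub {a, b}) \<notin> c ` Orig ` (pverts G - {b})"
    proof
      assume "c (Sub {a, b}) \<in> c ` Orig ` (pverts G - {b})"
      then obtain x where x: "x \<in> pverts G" "x \<noteq> b" "c (Sub {a, b}) = c (Orig x)" by auto
      then have "x = a" using single[OF _ Sub_in_central[OF arc] x(3)] by blast
      then show False using pair[OF Sub_in_central[OF arc]] x(3) by blast
    qed
    have inj: "inj_on (c \<circ> Orig) (pverts G - {b})"
    proof (rule inj_onI)
      fix x y assume xy: "x \<in> pverts G - {b}" "y \<in> pverts G - {b}" "(c \<circ> Orig) x = (c \<circ> Orig) y"
      have "Orig y = Orig x" if "x \<noteq> a" by (rule single) (use xy that in auto)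
      moreover have "Orig x = Orig y" if "y \<noteq> a" by (rule single) (use xy that in auto)
      ultimately show "x = y" by blast
    qed
    have fin: "finite (pverts G)" by (rule finite_pverts[OF G])
    have "card (pverts G) = Suc (card (pverts G - {b}))"
      using card_Suc_Diff1[OF fin ab(2)] by simp
    also have "\<dots> = card (insert (c (Sub {a, b})) (c ` Orig ` (pverts G - {b})))"
      using card_image[OF inj] fin new by (simp add: image_comp)
    also have "\<dots> \<le> card (c ` pverts ?H)"
      using finH Sub_in_central[OF arc] by (intro card_mono) auto
    finally show ?thesis .
  qed
  then show "enat (card (pverts G)) \<le> enat (card (c ` pverts ?H))" by simp
qed

section \<open>From colorings of the central graph to colorings of the complement\<close>

lemma td_chromatic_number_complement_le_central:
  assumes G: "pair_graph G"
    and two: "\<And>u. u \<in> pverts G \<Longrightarrow> \<exists>x y. x \<noteq> y \<and>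
      (u, x) \<in> parcs (complement_graph G) \<and> (u, y) \<in> parcs (complement_graph G)"
  shows "td_chromatic_number (complement_graph G) \<le> td_chromatic_number (central_graph G)"
proof (rule td_chromatic_number_ge)
  fix c assume c: "total_dominator_coloring (central_graph G) c"
  let ?H = "central_graph G" and ?V = "pverts G" and ?E = "parcs (complement_graph G)"
  have fin: "finite ?V" by (rule finite_pverts[OF G])
  have finH: "finite (pverts ?H)" by (rule finite_pverts[OF pair_graph_central_graph[OF G]])
  have symE: "(y, x) \<in> ?E" if "(x, y) \<in> ?E" for x y
    using that arc_sym[OF G] by (auto simp: arcs_complement_iff)
  define k where "k x = c (Orig x)" for x
  define U where "U = {v \<in> ?V. \<not> (\<exists>u \<in> ?V. \<forall>x \<in> ?V. k x = k u \<longrightarrow> (v, x) \<in> ?E)}"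
  have proper: "k u \<noteq> k v" if "(u, v) \<in> ?E" for u v
    using c that unfolding total_dominator_coloring_iff k_def by auto
  have edge: "(\<forall>z\<in>?V. k z = k u \<longrightarrow> z = u) \<or> (\<forall>z\<in>?V. k z = k v \<longrightarrow> z = v) \<or>
      k u = k v \<and> (\<forall>z\<in>?V. k z = k u \<longrightarrow> z = u \<or> z = v)" if "(u, v) \<in> parcs G" for u v
    using central_coloring_edge[OF G c that] unfolding k_def
    by (smt (verit) Orig_in_central central_vertex.inject(1) insertE singletonD)
  \<comment> \<open>Since \<open>u\<close> dominates no class of \<open>k\<close>, the class of its
    non-neighbour \<open>x\<close> contains some \<open>y\<close> not joined to \<open>u\<close> in
    the complement; as \<open>u\<close> and \<open>x\<close> differ in color, \<open>y\<close> is a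
    neighbour of \<open>u\<close> in \<open>G\<close>.\<close>
  have mate: "\<exists>y \<in> ?V. y \<noteq> x \<and> k y = k x \<and> (u, y) \<in> parcs G"
    if u: "u \<in> U" and ux: "(u, x) \<in> ?E" for u x
  proof -
    have x: "x \<in> ?V" using ux by (simp add: arcs_complement_iff)
    then obtain y where y: "y \<in> ?V" "k y = k x" "(u, y) \<notin> ?E" using u by (auto simp: U_def)
    moreover have "y \<noteq> u" using proper[OF ux] y by auto
    ultimately show ?thesis using ux u by (auto simp: U_def arcs_complement_iff)
  qed
  \<comment> \<open>Apply \<open>edge\<close> to \<open>u\<close> and the mate \<open>y\<close> of a
    non-neighbour \<open>x\<close>: the class of \<open>y\<close> also contains \<open>x\<close>, so
    it is neither \<open>{y}\<close> nor \<open>{u, y}\<close>, and only the singleton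
    \<open>{u}\<close> remains.\<close>
  have single: "z = u" if u: "u \<in> U" and z: "z \<in> ?V" "k z = k u" for u z
  proof -
    have "u \<in> ?V" using u by (simp add: U_def)
    from two[OF this] obtain x where x: "(u, x) \<in> ?E" by blast
    from mate[OF u x] obtain y where y: "y \<in> ?V" "y \<noteq> x" "k y = k x" "(u, y) \<in> parcs G" by blast
    have "x \<in> ?V" "x \<noteq> u" using x by (auto simp: arcs_complement_iff)
    then show ?thesis using edge[OF y(4)] y z by metis
  qed
  have clique: "(u, v) \<notin> ?E" if "u \<in> U" "v \<in> U" for u v
    using mate[OF that(1)] single[OF that(2)] by blast
  \<comment> \<open>Merging \<open>U\<close> destroys the classes of its members, so every
    \<open>z\<close> outside \<open>U\<close> must dominate a class that is not among them.\<close>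
  have dom_outside_U: "\<exists>u \<in> ?V. k u \<notin> k ` U \<and> (\<forall>x \<in> ?V. k x = k u \<longrightarrow> (z, x) \<in> ?E)"
    if z: "z \<in> ?V - U" for z
  proof -
    from z obtain u where u: "u \<in> ?V" "\<And>x. x \<in> ?V \<Longrightarrow> k x = k u \<Longrightarrow> (z, x) \<in> ?E"
      by (auto simp: U_def)
    show ?thesis
    proof (cases "k u \<in> k ` U")
      case False
      then show ?thesis using u by blast
    next
      case True
      then have uU: "u \<in> U" using single u(1) by (metis imageE)
      have uz: "(u, z) \<in> ?E" using u symE by blast
      from mate[OF uU uz] obtain z' where z': "z' \<in> ?V" "z' \<noteq> z" "k z' = k z" by blast
      from two[OF u(1)] obtain x1 x2 where x12: "x1 \<noteq> x2" "(u, x1) \<in> ?E" "(u, x2) \<in> ?E" by blast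
      \<comment> \<open>Equal colors would put \<open>x1\<close>, \<open>x2\<close> and the mate
        \<open>y\<close> of \<open>x1\<close> into one class; but by \<open>edge\<close> the
        adjacent vertices \<open>x1\<close> and \<open>y\<close> cannot share a class with a third
        vertex.\<close>
      have "k x1 \<noteq> k x2"
      proof
        assume eq: "k x1 = k x2"
        from mate[OF uU x12(2)] obtain y where
          y: "y \<in> ?V" "y \<noteq> x1" "k y = k x1" "(u, y) \<in> parcs G" by blast
        have V: "x1 \<in> ?V" "x2 \<in> ?V" using x12 by (auto simp: arcs_complement_iff)
        have "(x1, y) \<in> parcs G"
          using central_coloring_monochromatic_arc[OF c V(1) y(1)] y by (simp add: k_def)
        moreover have "x2 \<noteq> y" using x12 y by (auto simp: arcs_complement_iff)
        ultimately show False using edge[of x1 y] y V x12(1) eq by metis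
      qed
      then obtain x where x: "(u, x) \<in> ?E" "k x \<noteq> k z" using x12 by metis
      have xV: "x \<in> ?V" using x by (simp add: arcs_complement_iff)
      from mate[OF uU x(1)] obtain x' where x': "x' \<in> ?V" "x' \<noteq> x" "k x' = k x" by blast
      have "k x \<notin> k ` U" using single x' xV by (metis imageE)
      \<comment> \<open>The classes of \<open>z\<close> and \<open>y\<close> are distinct and
        neither is a singleton, which \<open>edge\<close> rules out for the ends of an edge of
        \<open>G\<close>.\<close>
      moreover have "(z, y) \<in> ?E" if y: "y \<in> ?V" "k y = k x" for y
      proof -
        have "\<exists>y' \<in> ?V. y' \<noteq> y \<and> k y' = k y" using x' xV y by metis
        then have "(z, y) \<notin> parcs G" using edge[of z y] z' x(2) y by metis
        then show ?thesis using y z x(2) by (auto simp: arcs_complement_iff)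
      qed
      ultimately show ?thesis using xV by blast
    qed
  qed
  have bound: "td_chromatic_number (complement_graph G) \<le> enat m"
    if "card (k ` ?V) \<le> m" and m: "U \<noteq> {} \<Longrightarrow> card (k ` ?V) + 1 \<le> m" for m
  proof (cases "U = {}")
    case True
    show ?thesis
      by (rule td_chromatic_number_le[where c = k, OF pair_graph_complement_graph[OF G]])
        (use True proper that(1) in \<open>auto simp: U_def\<close>)
  next
    case False
    have "\<forall>u \<in> U. \<exists>x. (u, x) \<in> ?E" using two by (auto simp: U_def)
    then obtain f where f: "\<And>u. u \<in> U \<Longrightarrow> (u, f u) \<in> ?E" by metis
    have fU: "f u \<in> ?V - U" if "u \<in> U" for u
      using f[OF that] clique[OF that] by (auto simp: arcs_complement_iff)
    \<comment> \<open>\<open>None\<close> is the merged class \<open>U\<close>, the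
      \<open>Inl\<close> colors isolate the chosen non-neighbours, and \<open>Inr\<close> keeps the
      old color. Outside \<open>U\<close> this refines \<open>k\<close>, so domination of a class
      disjoint from \<open>U\<close> survives; inside \<open>U\<close> properness holds by
      \<open>clique\<close>.\<close>
    define k' where "k' x = (if x \<in> U then None else if x \<in> f ` U then Some (Inl x)
      else Some (Inr (k x)))" for x
    show ?thesis
    proof (rule td_chromatic_number_le[where c = k', OF pair_graph_complement_graph[OF G]])
      fix u v assume "(u, v) \<in> ?E"
      then show "k' u \<noteq> k' v" using proper[of u v] clique[of u v]
        by (auto simp: k'_def arcs_complement_iff)
    next
      fix v assume "v \<in> pverts (complement_graph G)"
      then have v: "v \<in> ?V" by simp
      have "\<exists>u \<in> ?V. \<forall>x \<in> ?V. k' x = k' u \<longrightarrow> (v, x) \<in> ?E"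
      proof (cases "v \<in> U")
        case True
        then show ?thesis using f[OF True] fU
          by (intro bexI[of _ "f v"]) (auto simp: k'_def split: if_splits)
      next
        case False
        then obtain u where u: "u \<in> ?V" "k u \<notin> k ` U" "\<And>x. x \<in> ?V \<Longrightarrow> k x = k u \<Longrightarrow> (v, x) \<in> ?E"
          using dom_outside_U[of v] v by blast
        then have "\<forall>x \<in> ?V. k' x = k' u \<longrightarrow> (v, x) \<in> ?E"
          by (auto simp: k'_def split: if_splits)
        then show ?thesis using u(1) by blast
      qed
      then show "\<exists>u \<in> pverts (complement_graph G). \<forall>x \<in> pverts (complement_graph G).
        k' x = k' u \<longrightarrow> (v, x) \<in> ?E" by simp
    next
      have finU: "finite U" using fin by (simp add: U_def)
      have UV: "U \<subseteq> ?V" by (auto simp: U_def)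
      have disj: "k ` U \<inter> k ` (?V - U) = {}" using single by fastforce
      have injU: "inj_on k U" using single UV by (auto simp: inj_on_def)
      have "k ` ?V = k ` U \<union> k ` (?V - U)" using UV by auto
      \<comment> \<open>The members of \<open>U\<close> account for \<open>card U\<close> old
        colors, which pay for the new singletons; only \<open>None\<close> is extra.\<close>
      then have card_k: "card (k ` ?V) = card U + card (k ` (?V - U))"
        using card_Un_disjoint[OF _ _ disj] finU fin by (simp add: card_image[OF injU])
      have "k' ` ?V \<subseteq> insert None (Some ` (Inl ` f ` U \<union> Inr ` k ` (?V - U)))"
        by (auto simp: k'_def)
      then have "card (k' ` ?V) \<le> card (insert None (Some ` (Inl ` f ` U \<union> Inr ` k ` (?V - U))))"
        using fin finU by (intro card_mono) auto
      also have "\<dots> \<le> Suc (card (Some ` (Inl ` f ` U \<union> Inr ` k ` (?V - U))))"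
        by (simp add: card_insert_if fin finU)
      also have "card (Some ` (Inl ` f ` U \<union> Inr ` k ` (?V - U))) =
          card (Inl ` f ` U \<union> Inr ` k ` (?V - U))"
        by (rule card_image) simp
      also have "\<dots> \<le> card (f ` U) + card (k ` (?V - U))"
        by (rule order_trans[OF card_Un_le]) (simp add: card_image)
      also have "\<dots> \<le> card (k ` ?V)" using card_image_le[OF finU, of f] card_k by simp
      finally show "card (k' ` pverts (complement_graph G)) \<le> m" using m[OF False] by simp
    qed
  qed
  have sub: "k ` ?V \<subseteq> c ` pverts ?H" by (auto simp: k_def)
  show "td_chromatic_number (complement_graph G) \<le> enat (card (c ` pverts ?H))"
  proof (rule bound)
    show "card (k ` ?V) \<le> card (c ` pverts ?H)" using sub finH by (intro card_mono) auto
    assume "U \<noteq> {}"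
    then obtain v where v: "v \<in> U" by blast
    then have "Orig v \<in> pverts ?H" by (simp add: U_def)
    then obtain w where w: "w \<in> pverts ?H"
      "\<And>x. x \<in> pverts ?H \<Longrightarrow> c x = c w \<Longrightarrow> (Orig v, x) \<in> parcs ?H"
      using c unfolding total_dominator_coloring_iff by blast
    \<comment> \<open>The class dominated by \<open>Orig v\<close> contains no original vertex,
      since otherwise its original part would be a class of \<open>k\<close> dominated by
      \<open>v\<close>. So \<open>c\<close> has a color to spare for \<open>None\<close>.\<close>
    have "c w \<notin> k ` ?V"
    proof
      assume "c w \<in> k ` ?V"
      then obtain u where u: "u \<in> ?V" "c w = k u" by auto
      have "(v, x) \<in> ?E" if "x \<in> ?V" "k x = k u" for x
        using w(2)[of "Orig x"] that u by (simp add: k_def)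
      then show False using v u(1) by (auto simp: U_def)
    qed
    then have "card (k ` ?V) + 1 = card (insert (c w) (k ` ?V))" using fin by simp
    also have "\<dots> \<le> card (c ` pverts ?H)" using finH sub w(1) by (intro card_mono) auto
    finally show "card (k ` ?V) + 1 \<le> card (c ` pverts ?H)" .
  qed
qed

section \<open>Complete bipartite graphs, which include both extremal examples\<close>

definition complete_bipartite :: "'a set \<Rightarrow> 'a set \<Rightarrow> 'a pair_pre_digraph" where
  "complete_bipartite A B = \<lparr>pverts = A \<union> B, parcs = A \<times> B \<union> B \<times> A\<rparr>"

context
  fixes A B :: "'a set"
  assumes fin: "finite A" "finite B" and ne: "A \<noteq> {}" "B \<noteq> {}" and disj: "A \<inter> B = {}"
begin

lemma pair_graph_complete_bipartite: "pair_graph (complete_bipartite A B)"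
  using fin disj by unfold_locales (auto simp: complete_bipartite_def symmetric_def intro!: symI)

lemma connected_complete_bipartite: "connected (with_proj (complete_bipartite A B))"
proof -
  interpret pair_graph "complete_bipartite A B" by (rule pair_graph_complete_bipartite)
  let ?G = "with_proj (complete_bipartite A B)"
  have arc: "x \<rightarrow>\<^sup>*\<^bsub>?G\<^esub> y" if "x \<in> A \<and> y \<in> B \<or> x \<in> B \<and> y \<in> A" for x y
    using that by (intro reachable_adjI) (auto simp: complete_bipartite_def)
  \<comment> \<open>Two vertices of the same part are joined through any vertex of the other
    part.\<close>
  have "x \<rightarrow>\<^sup>*\<^bsub>?G\<^esub> y" if "x \<in> A \<union> B" "y \<in> A \<union> B" for x y
    using that ne arc reachable_trans by (metis Un_iff all_not_in_conv)
  then show ?thesis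
    using ne reachable_mk_symmetric_eq[OF pair_sym_arcs]
    by (intro connectedI) (auto simp: complete_bipartite_def)
qed

text \<open>An edge has an end in each part, so any third vertex is adjacent to the end in the
  opposite part; thus every edge is dominating.\<close>

lemma td_chromatic_number_central_complete_bipartite:
  "enat (card (A \<union> B)) \<le> td_chromatic_number (central_graph (complete_bipartite A B))"
  using card_pverts_le_td_chromatic_number_central[OF pair_graph_complete_bipartite] ne
  by (auto simp: complete_bipartite_def)

end

lemma max_degree_complete_bipartite_le:
  assumes "finite A" "finite B" "A \<noteq> {}" "A \<inter> B = {}"
  shows "max_degree (complete_bipartite A B) \<le> max (card A) (card B)"
proof -
  have "out_arcs (with_proj (complete_bipartite A B)) u =
      Pair u ` (if u \<in> A then B else if u \<in> B then A else {})" for u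
    using assms(4) by (auto simp: out_arcs_def complete_bipartite_def)
  then have "out_degree (with_proj (complete_bipartite A B)) u \<le> max (card A) (card B)" for u
    by (simp add: out_degree_def card_image inj_on_def)
  then show ?thesis using assms unfolding max_degree_def by (auto simp: complete_bipartite_def)
qed

text \<open>Every second vertex of a walk in a star is the centre. Among the first four vertices of
  a closed walk of length at least 3 the centre therefore recurs after two steps, which a cycle
  forbids.\<close>

lemma undirected_tree_star:
  assumes "finite B" "B \<noteq> {}" "v \<notin> B"
  shows "undirected_tree (complete_bipartite {v} B)"
proof -
  let ?G = "complete_bipartite {v} B"
  interpret pair_graph ?G using assms by (intro pair_graph_complete_bipartite) auto
  have False if cyc: "cycle p" and len: "3 \<le> length p" for p
  proof -
    obtain e1 e2 e3 q where p: "p = e1 # e2 # e3 # q"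
      using len by (auto simp: numeral_3_eq_3 Suc_le_length_iff)
    obtain u where u: "awalk u p u" "distinct (tl (pawalk_verts u p))" using cyc by (auto simp: cycle_def)
    have arcs: "e1 \<in> parcs ?G" "e2 \<in> parcs ?G" "e3 \<in> parcs ?G" using u(1) p by (auto simp: awalk_def)
    have walk: "snd e1 = fst e2" "snd e2 = fst e3" "fst e1 = u" "pcas (snd e3) q u"
      using u(1) p by (auto simp: awalk_def)
    have last: "last (pawalk_verts (snd e3) q) = u"
      by (rule awlast_if_cas[OF walk(4)])
    have hd: "snd e3 \<in> set (pawalk_verts (snd e3) q)"
      using walk(4) by (cases q) auto
    \<comment> \<open>Distinctness concerns the tail of the vertex list, which drops the initial
      \<open>u\<close>; the final \<open>u\<close> is what separates \<open>fst e3\<close> from the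
      start.\<close>
    have "u \<in> set (pawalk_verts (snd e3) q)"
      using last by (metis awalk_verts_non_Nil last_in_set)
    then have neq: "fst e2 \<noteq> fst e3" "fst e2 \<noteq> snd e3" "fst e3 \<noteq> u"
      using u(2) p hd by auto
    show False
      using arcs walk neq assms(3) unfolding complete_bipartite_def by auto
  qed
  then show ?thesis
    unfolding undirected_tree_def using connected_complete_bipartite[of "{v}" B] assms by auto
qed

theorem theorem6p1:
  shows
    "(\<forall>G :: 'a pair_pre_digraph.
        pair_graph G \<and> connected (with_proj G) \<and> 5 \<le> card (pverts G) \<longrightarrow>
        (max_degree G \<le> card (pverts G) - 3 \<longrightarrow>
           td_chromatic_number (complement_graph G) \<le> td_chromatic_number (central_graph G) \<and>
           td_chromatic_number (central_graph G) \<le> enat (max_degree (central_graph G) + 1)) \<and>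
        (undirected_tree G \<longrightarrow>
           td_chromatic_number (central_graph G) \<le> enat (max_degree (central_graph G) + 1)))
     \<and> (\<exists>G :: nat pair_pre_digraph.
        pair_graph G \<and> connected (with_proj G) \<and> 5 \<le> card (pverts G) \<and>
        max_degree G \<le> card (pverts G) - 3 \<and>
        td_chromatic_number (central_graph G) = enat (max_degree (central_graph G) + 1))
     \<and> (\<exists>G :: nat pair_pre_digraph.
        pair_graph G \<and> connected (with_proj G) \<and> 5 \<le> card (pverts G) \<and>
        undirected_tree G \<and>
        td_chromatic_number (central_graph G) = enat (max_degree (central_graph G) + 1))"
proof (intro conjI allI impI)
  fix G :: "'a pair_pre_digraph"
  assume *: "pair_graph G \<and> connected (with_proj G) \<and> 5 \<le> card (pverts G)"
  have deg: "max_degree (central_graph G) + 1 = card (pverts G)"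
    using max_degree_central[of G] * by simp
  show "td_chromatic_number (central_graph G) \<le> enat (max_degree (central_graph G) + 1)"
    if "max_degree G \<le> card (pverts G) - 3"
    unfolding deg using * that by (intro td_chromatic_number_central_le_low_degree) auto
  show "td_chromatic_number (complement_graph G) \<le> td_chromatic_number (central_graph G)"
    if "max_degree G \<le> card (pverts G) - 3"
    using * that by (intro td_chromatic_number_complement_le_central) (auto intro: ex_two_non_neighbours)
  show "td_chromatic_number (central_graph G) \<le> enat (max_degree (central_graph G) + 1)"
    if "undirected_tree G"
    unfolding deg using * that by (intro td_chromatic_number_central_le_tree) auto
next
  \<comment> \<open>Parts of size 3 give order 6 and degree 3, so the degree hypothesis holds with
    equality.\<close>
  let ?K = "complete_bipartite {0, 1, 2} {3, 4, 5 :: nat}"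
  have G: "pair_graph ?K" and con: "connected (with_proj ?K)"
    by (intro pair_graph_complete_bipartite connected_complete_bipartite; simp)+
  have V: "card (pverts ?K) = 6" by (simp add: complete_bipartite_def)
  have d: "max_degree ?K \<le> card (pverts ?K) - 3"
    using max_degree_complete_bipartite_le[of "{0, 1, 2}" "{3, 4, 5 :: nat}"] V by simp
  have "td_chromatic_number (central_graph ?K) \<le> enat (card (pverts ?K))"
    using V d by (intro td_chromatic_number_central_le_low_degree[OF G con]) auto
  moreover have "enat (card (pverts ?K)) \<le> td_chromatic_number (central_graph ?K)"
    using td_chromatic_number_central_complete_bipartite[of "{0, 1, 2}" "{3, 4, 5 :: nat}"]
    by (simp add: complete_bipartite_def)
  moreover have "max_degree (central_graph ?K) + 1 = card (pverts ?K)"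
    using max_degree_central[OF G] V by simp
  ultimately show "\<exists>G :: nat pair_pre_digraph.
        pair_graph G \<and> connected (with_proj G) \<and> 5 \<le> card (pverts G) \<and>
        max_degree G \<le> card (pverts G) - 3 \<and>
        td_chromatic_number (central_graph G) = enat (max_degree (central_graph G) + 1)"
    using G con V d by (intro exI[of _ ?K]) auto
next
  let ?K = "complete_bipartite {0} {1, 2, 3, 4 :: nat}"
  have G: "pair_graph ?K" and con: "connected (with_proj ?K)"
    by (intro pair_graph_complete_bipartite connected_complete_bipartite; simp)+
  have V: "card (pverts ?K) = 5" by (simp add: complete_bipartite_def)
  have tree: "undirected_tree ?K" by (rule undirected_tree_star) auto
  have "td_chromatic_number (central_graph ?K) \<le> enat (card (pverts ?K))"
    using V tree by (intro td_chromatic_number_central_le_tree[OF G con]) auto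
  moreover have "enat (card (pverts ?K)) \<le> td_chromatic_number (central_graph ?K)"
    using td_chromatic_number_central_complete_bipartite[of "{0}" "{1, 2, 3, 4 :: nat}"]
    by (simp add: complete_bipartite_def)
  moreover have "max_degree (central_graph ?K) + 1 = card (pverts ?K)"
    using max_degree_central[OF G] V by simp
  ultimately show "\<exists>G :: nat pair_pre_digraph.
        pair_graph G \<and> connected (with_proj G) \<and> 5 \<le> card (pverts G) \<and>
        undirected_tree G \<and>
        td_chromatic_number (central_graph G) = enat (max_degree (central_graph G) + 1)"
    using G con V tree by (intro exI[of _ ?K]) auto
qed

end
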